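(* Let $A=(a(i,j))_{i,j\ge 0}$ be the infinite lower triangular matrix with $a(n,k)=(-1)^{n-k}\frac{1}{2k+1}\binom{2n+2}{2k}G_{2n-2k+2}$ for $0\le k\le n$ and $a(n,k)=0$ for $k>n$. Let $x=(x_n)_{n\ge 0}$ and $y=(y_n)_{n\ge0}$ be sequences of numbers, regarded as infinite column vectors. Then $y=Ax$ is equivalent to the identity of formal power series $$\sum_{n\ge 0}y_n\frac{z^{2n+2}}{(2n+2)!}=\frac{e^z-1}{e^z+1}\sum_{n\ge 0}\frac{x_n}{(2n+1)!}z^{2n+1}.$$
   Context: The Genocchi numbers $G_{2n}$, $n\ge1$ ($1,1,3,17,155,\dots$), are defined by $\frac{2z}{1+e^z}=z+\sum_{n\ge 1}(-1)^nG_{2n}\frac{z^{2n}}{(2n)!}$. *)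

theory Defs
  imports "HOL-Computational_Algebra.Formal_Power_Series"
begin

text \<open>
  The argument is the full index \<open>m\<close> of \<open>G\<^sub>m\<close>, so that \<open>genocchi (2 * n)\<close> is \<open>G\<^bsub>2n\<^esub>\<close>.
  The value at an odd or zero index is without significance. The defining identity is
  \<open>genocchi_generating_function\<close> below.
\<close>

definition genocchi :: "nat \<Rightarrow> 'a::field_char_0" where
  "genocchi m = (-1) ^ (m div 2) * fact m * fps_nth (2 * fps_X / (1 + fps_exp 1)) m"

definition genocchi_matrix :: "nat \<Rightarrow> nat \<Rightarrow> 'a::field_char_0" where
  "genocchi_matrix n k =
     (if k \<le> n then (-1) ^ (n - k) * (1 / of_nat (2 * k + 1)) *
        of_nat ((2 * n + 2) choose (2 * k)) * genocchi (2 * n - 2 * k + 2)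
      else 0)"

text \<open>
  Infinite matrix times infinite column vector. Meaningful only if every row of \<open>A\<close> has
  finitely many non-zero entries, as is the case for lower triangular \<open>A\<close>.
\<close>

definition inf_mat_vec :: "(nat \<Rightarrow> nat \<Rightarrow> 'a::semiring_0) \<Rightarrow> (nat \<Rightarrow> 'a) \<Rightarrow> nat \<Rightarrow> 'a" where
  "inf_mat_vec A x n = (\<Sum>k | A n k \<noteq> 0. A n k * x k)"

text \<open>
  Infinite sums of formal power series are taken with respect to the library's metric on
  \<^typ>\<open>'a fps\<close>. The following lemma shows that all the sums used here converge, and to
  the series with the expected coefficients.
\<close>

lemma fps_monomials_sums:
  fixes c :: "nat \<Rightarrow> 'a::comm_ring_1"
  assumes "strict_mono e"
  shows "(\<lambda>n. fps_const (c n) * fps_X ^ e n) sums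
           Abs_fps (\<lambda>m. if m \<in> range e then c (inv e m) else 0)"
  unfolding sums_def
proof (rule tendsto_fpsI)
  fix m
  have inj: "inj e" using assms by (rule strict_mono_imp_inj_on)
  have ge: "k \<le> e k" for k using assms by (rule strict_mono_imp_increasing)
  have coeff: "fps_nth (\<Sum>k<N. fps_const (c k) * fps_X ^ e k) m = 
                 (\<Sum>k<N. if e k = m then c k else 0)" for N
    by (auto simp: fps_sum_nth fps_X_power_nth intro!: sum.cong)
  show "eventually (\<lambda>N. fps_nth (\<Sum>k<N. fps_const (c k) * fps_X ^ e k) m =
          fps_nth (Abs_fps (\<lambda>m. if m \<in> range e then c (inv e m) else 0)) m) sequentially"
    using eventually_gt_at_top[of m]
  proof eventually_elim
    case (elim N)
    show ?case
    proof (cases "m \<in> range e")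
      case True
      then obtain k where k: "m = e k" by auto
      with ge[of k] elim have "k < N" by simp
      have "(\<Sum>j<N. if e j = m then c j else 0) = (\<Sum>j<N. if j = k then c j else 0)"
        using inj k by (intro sum.cong) (auto simp: inj_eq)
      also have "\<dots> = c k" using \<open>k < N\<close> by simp
      finally show ?thesis using inj by (simp add: coeff) (simp add: k)
    next
      case False
      then have "(\<Sum>j<N. if e j = m then c j else 0) = 0"
        by (intro sum.neutral) auto
      with False show ?thesis by (simp add: coeff)
    qed
  qed
qed

lemma genocchi_generating_function:
  "2 * fps_X / (1 + fps_exp (1::'a::field_char_0)) =
     fps_X + (\<Sum>n. fps_const ((-1) ^ (n + 1) * genocchi (2 * (n + 1)) / fact (2 * (n + 1))) *
                    fps_X ^ (2 * (n + 1)))"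
proof -
  define E where "E = fps_exp (1::'a)"
  define F where "F = 2 * fps_X / (1 + E)"
  have nz: "1 + E \<noteq> 0" "fps_nth (1 + E) 0 \<noteq> 0" 
    by (auto simp: E_def fps_eq_iff intro!: exI[of _ 0])
  have FE: "F * (1 + E) = 2 * fps_X"
    unfolding F_def using nz(2) by (simp add: fps_divide_unit mult.assoc inverse_mult_eq_1)
  define F' where "F' = F oo (- fps_X)"
  have "(F * (1 + E)) oo (- fps_X) = (2 * fps_X) oo (- fps_X)"
    by (simp only: FE)
  then have "F' * (1 + fps_exp (-1)) = - (2 * fps_X)"
    unfolding F'_def E_def
    by (simp add: fps_compose_mult_distrib fps_compose_add_distrib)
  then have "F' * (1 + fps_exp (-1)) * E = - (2 * fps_X) * E"
    by simp
  moreover have "fps_exp (-1) * E = 1"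
    using fps_exp_add_mult[of "-1" "1::'a"] by (simp add: E_def)
  moreover have "F' * (1 + fps_exp (-1)) * E = F' * (E + fps_exp (-1) * E)"
    by (simp add: algebra_simps)
  ultimately have F'E: "F' * (1 + E) = - (2 * fps_X) * E"
    by (simp add: add.commute)
  have "(F - F') * (1 + E) = 2 * fps_X * (1 + E)"
    by (simp only: left_diff_distrib FE F'E) (simp add: algebra_simps)
  then have "F - F' = 2 * fps_X"
    using nz(1) by simp
  moreover have "fps_nth F' m = (-1) ^ m * fps_nth F m" for m
    unfolding F'_def fps_compose_uminus' by simp
  ultimately have *: "fps_nth F m - (-1) ^ m * fps_nth F m = (if m = 1 then 2 else 0)" for m
    by (metis (no_types, lifting) fps_sub_nth fps_X_nth fps_numeral_nth_0 mult.right_neutral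
        mult_zero_right numeral_fps_const fps_mult_left_const_nth)
  have F_odd: "fps_nth F m = (if m = 1 then 1 else 0)" if "odd m" for m
    using *[of m] that by (auto split: if_splits simp flip: mult_2)
  have F_0: "fps_nth F 0 = 0"
    using arg_cong[OF FE, of "\<lambda>f. fps_nth f 0"] nz(2) by simp
  define e where "e n = 2 * (n + 1)" for n :: nat
  have e: "strict_mono e" by (auto simp: e_def strict_mono_def)
  then have inv_e: "inv e (e n) = n" for n
    by (simp add: strict_mono_imp_inj_on)
  have range_e: "m \<in> range e \<longleftrightarrow> even m \<and> m \<noteq> 0" for m
  proof
    assume m: "even m \<and> m \<noteq> 0"
    then obtain k where "m = 2 * k" by blast
    with m have "m = e (k - 1)" by (simp add: e_def)
    then show "m \<in> range e" by blast
  qed (auto simp: e_def)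
  have gen: "(-1) ^ (n + 1) * genocchi (e n) / fact (e n) = fps_nth F (e n)" for n
  proof -
    have "genocchi (e n) = (-1) ^ (n + 1) * fact (e n) * fps_nth F (e n)"
      by (simp only: genocchi_def F_def E_def) (simp add: e_def)
    moreover have "(-1) ^ (n + 1) * (-1) ^ (n + 1) = (1::'a)"
      by (simp flip: power_mult_distrib)
    ultimately show ?thesis
      by (simp only: mult.assoc[symmetric]) simp
  qed
  have "(\<Sum>n. fps_const ((-1) ^ (n + 1) * genocchi (e n) / fact (e n)) * fps_X ^ e n) =
          Abs_fps (\<lambda>m. if m \<in> range e
                       then (-1) ^ (inv e m + 1) * genocchi (e (inv e m)) / fact (e (inv e m)) else 0)"
    by (rule sums_unique[symmetric, OF fps_monomials_sums[OF e]])
  also have "\<dots> = F - fps_X"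
  proof (rule fps_ext)
    fix m
    show "fps_nth (Abs_fps (\<lambda>m. if m \<in> range e
             then (-1) ^ (inv e m + 1) * genocchi (e (inv e m)) / fact (e (inv e m)) else 0)) m =
          fps_nth (F - fps_X) m"
    proof (cases "m \<in> range e")
      case True
      then obtain n where "m = e n" by auto
      moreover have "fps_nth fps_X (e n) = (0::'a)" by (simp add: e_def)
      ultimately show ?thesis using gen[of n] inv_e[of n] by simp
    next
      case False
      with range_e[of m] F_odd[of m] F_0 show ?thesis by (cases "m = 0") auto
    qed
  qed
  finally show ?thesis by (simp add: F_def E_def e_def)
qed

end

theory Submission
  imports Defs
begin

text \<open>
  Let \<open>T = (e\<^sup>z - 1) / (e\<^sup>z + 1)\<close>. Then \<open>z T = z - 2 z / (1 + e\<^sup>z)\<close>, so \<open>T\<close> is odd and its odd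
  coefficients are Genocchi numbers divided by factorials. Hence the product of \<open>T\<close> with an odd
  series is even, and its coefficient at \<open>z\<^bsup>2n+2\<^esup>\<close> is the \<open>n\<close>-th entry of \<open>A x\<close> divided by
  \<open>(2n+2)!\<close>.
\<close>

text \<open>Reads coefficients off the limit given by \<open>fps_monomials_sums\<close>; injectivity
  of \<open>e\<close> turns \<open>inv e (e k)\<close> into \<open>k\<close>.\<close>

lemma fps_nth_suminf_monomials:
  fixes c :: "nat \<Rightarrow> 'a::comm_ring_1"
  assumes "strict_mono e"
  shows "fps_nth (\<Sum>n. fps_const (c n) * fps_X ^ e n) (e k) = c k"
    and "m \<notin> range e \<Longrightarrow> fps_nth (\<Sum>n. fps_const (c n) * fps_X ^ e n) m = 0"
  using assms
  by (simp_all add: sums_unique[OF fps_monomials_sums[OF assms], symmetric]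
      strict_mono_imp_inj_on)

text \<open>Solves the definition of \<open>genocchi\<close> for the coefficient: the sign is its
  own inverse.\<close>

lemma fps_nth_genocchi_series:
  "fps_nth (2 * fps_X / (1 + fps_exp (1::'a::field_char_0))) m =
     (-1) ^ (m div 2) * genocchi m / fact m"
  by (simp add: genocchi_def flip: power_mult_distrib mult.assoc)

text \<open>The sum in \<open>genocchi_generating_function\<close> has only even exponents, so at
  odd indices only \<open>fps_X\<close> contributes.\<close>

lemma fps_nth_genocchi_series_odd:
  assumes "odd m"
  shows "fps_nth (2 * fps_X / (1 + fps_exp (1::'a::field_char_0))) m = fps_nth fps_X m"
proof -
  have "m \<notin> range (\<lambda>n. 2 * (n + 1))" using assms by auto
  moreover have "strict_mono (\<lambda>n::nat. 2 * (n + 1))" by (auto simp: strict_mono_def)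
  ultimately show ?thesis
    unfolding genocchi_generating_function fps_add_nth
    by (subst fps_nth_suminf_monomials(2)) simp_all
qed

context
  fixes T :: "'a::field_char_0 fps"
  defines "T \<equiv> (fps_exp 1 - 1) / (fps_exp 1 + 1)"
begin

text \<open>Write \<open>fps_exp 1 - 1\<close> as \<open>(1 + fps_exp 1) - 2\<close>. The constant
  term of \<open>1 + fps_exp 1\<close> is nonzero, so dividing by it is multiplying by its
  inverse.\<close>

lemma fps_X_mult_half_tanh: "fps_X * T = fps_X - 2 * fps_X / (1 + fps_exp 1)"
proof -
  have u: "fps_nth (1 + fps_exp (1::'a)) 0 \<noteq> 0" by simp
  have T: "T = (fps_exp 1 - 1) * inverse (1 + fps_exp 1)"
    unfolding T_def using u by (simp add: fps_divide_unit add.commute)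
  have F: "2 * fps_X / (1 + fps_exp (1::'a)) = 2 * fps_X * inverse (1 + fps_exp 1)"
    by (rule fps_divide_unit[OF u])
  have "fps_X * T = fps_X * ((1 + fps_exp 1) * inverse (1 + fps_exp 1)) -
      2 * fps_X * inverse (1 + fps_exp 1)"
    unfolding T by algebra
  then show ?thesis
    unfolding F inverse_mult_eq_1'[OF u] by simp
qed

lemma fps_nth_half_tanh:
  "fps_nth T m = fps_nth fps_X (Suc m) - fps_nth (2 * fps_X / (1 + fps_exp 1)) (Suc m)"
  using arg_cong[OF fps_X_mult_half_tanh, of "\<lambda>f. fps_nth f (Suc m)"] by simp

text \<open>Here \<open>Suc m\<close> is odd, and the two series agree there. Keeping
  \<open>fps_nth fps_X\<close> folded lets the terms cancel.\<close>

lemma fps_nth_half_tanh_even: "even m \<Longrightarrow> fps_nth T m = 0"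
  by (simp add: fps_nth_half_tanh fps_nth_genocchi_series_odd del: fps_X_nth)

text \<open>The index moves up to \<open>2 * (j + 1)\<close>, with sign
  \<open>(-1) ^ (j + 1)\<close>; the subtraction lowers the exponent to \<open>j\<close>.\<close>

lemma fps_nth_half_tanh_odd:
  "fps_nth T (2 * j + 1) = (-1) ^ j * genocchi (2 * j + 2) / fact (2 * j + 2)"
  by (simp add: fps_nth_half_tanh fps_nth_genocchi_series)

text \<open>In the convolution a term survives only if both indices are odd. Their sum is then even,
  and the index of \<open>S\<close> is some \<open>2 * k + 1\<close>.\<close>

lemma fps_nth_mult_half_tanh:
  assumes "\<And>m. even m \<Longrightarrow> fps_nth S m = 0"
  shows "odd N \<Longrightarrow> fps_nth (T * S) N = 0"
    and "fps_nth (T * S) (2 * n + 2) =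
           (\<Sum>k\<le>n. fps_nth S (2 * k + 1) *
             ((-1) ^ (n - k) * genocchi (2 * n - 2 * k + 2) / fact (2 * n - 2 * k + 2)))"
proof -
  have ST: "fps_nth (T * S) N = (\<Sum>i=0..N. fps_nth S i * fps_nth T (N - i))" for N
    by (simp only: mult.commute[of T] fps_mult_nth)
  show "fps_nth (T * S) N = 0" if "odd N"
    unfolding ST
  proof (intro sum.neutral ballI)
    fix i assume "i \<in> {0..N}"
    then show "fps_nth S i * fps_nth T (N - i) = 0"
      using assms[of i] fps_nth_half_tanh_even[of "N - i"] that by (cases "even i") auto
  qed
  have "fps_nth (T * S) (2 * n + 2) =
      (\<Sum>i\<in>(\<lambda>k. 2 * k + 1) ` {..n}. fps_nth S i * fps_nth T (2 * n + 2 - i))"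
    unfolding ST
  proof (rule sum.mono_neutral_right)
    show "\<forall>i\<in>{0..2 * n + 2} - (\<lambda>k. 2 * k + 1) ` {..n}.
            fps_nth S i * fps_nth T (2 * n + 2 - i) = 0"
    proof
      fix i assume i: "i \<in> {0..2 * n + 2} - (\<lambda>k. 2 * k + 1) ` {..n}"
      have "even i"
      proof (rule ccontr)
        assume "odd i"
        then obtain k where "i = 2 * k + 1" by (elim oddE)
        with i show False by auto
      qed
      then show "fps_nth S i * fps_nth T (2 * n + 2 - i) = 0" by (simp add: assms)
    qed
  qed auto
  also have "\<dots> = (\<Sum>k\<le>n. fps_nth S (2 * k + 1) * fps_nth T (2 * n + 2 - (2 * k + 1)))"
    by (subst sum.reindex) (auto simp: inj_on_def)
  also have "\<dots> = (\<Sum>k\<le>n. fps_nth S (2 * k + 1) *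
      ((-1) ^ (n - k) * genocchi (2 * n - 2 * k + 2) / fact (2 * n - 2 * k + 2)))"
  proof (rule sum.cong)
    fix k assume "k \<in> {..n}"
    \<comment> \<open>Subtraction on \<open>nat\<close> truncates; both equations rely on
      \<open>k \<le> n\<close>.\<close>
    then have i: "2 * n + 2 - (2 * k + 1) = 2 * (n - k) + 1" "2 * n - 2 * k + 2 = 2 * (n - k) + 2"
      by auto
    show "fps_nth S (2 * k + 1) * fps_nth T (2 * n + 2 - (2 * k + 1)) =
        fps_nth S (2 * k + 1) *
        ((-1) ^ (n - k) * genocchi (2 * n - 2 * k + 2) / fact (2 * n - 2 * k + 2))"
      unfolding i fps_nth_half_tanh_odd ..
  qed simp
  finally show "fps_nth (T * S) (2 * n + 2) =
      (\<Sum>k\<le>n. fps_nth S (2 * k + 1) *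
        ((-1) ^ (n - k) * genocchi (2 * n - 2 * k + 2) / fact (2 * n - 2 * k + 2)))" .
qed

end

lemma inf_mat_vec_lower_triangular:
  assumes "\<And>k. k > n \<Longrightarrow> A n k = 0"
  shows "inf_mat_vec A x n = (\<Sum>k\<le>n. A n k * x k)"
  unfolding inf_mat_vec_def
  by (rule sum.mono_neutral_left) (use assms in \<open>auto simp: not_less[symmetric]\<close>)

text \<open>Expanding the binomial in factorials leaves \<open>fact (2 * k)\<close> in the
  denominator, which the factor \<open>2 * k + 1\<close> completes to
  \<open>fact (2 * k + 1)\<close>. This matches the convolution terms.\<close>

lemma genocchi_matrix_altdef:
  assumes "k \<le> n"
  shows "(genocchi_matrix n k :: 'a::field_char_0) =
    fact (2 * n + 2) * ((-1) ^ (n - k) * genocchi (2 * n - 2 * k + 2) / fact (2 * n - 2 * k + 2)) /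
      fact (2 * k + 1)"
proof -
  have "2 * n + 2 - 2 * k = 2 * n - 2 * k + 2" using assms by simp
  then have "of_nat ((2 * n + 2) choose (2 * k)) =
      (fact (2 * n + 2) / (fact (2 * k) * fact (2 * n - 2 * k + 2)) :: 'a)"
    using assms by (subst binomial_fact) auto
  moreover have "fact (2 * k + 1) = (of_nat (2 * k + 1) * fact (2 * k) :: 'a)"
    by (metis Suc_eq_plus1 fact_Suc)
  ultimately show ?thesis
    using assms by (simp only: genocchi_matrix_def if_True) (simp only: divide_simps, simp)
qed

theorem proposition4p1:
  fixes x y :: "nat \<Rightarrow> 'a::field_char_0"
  shows "y = inf_mat_vec genocchi_matrix x \<longleftrightarrow>
    (\<Sum>n. fps_const (y n / fact (2 * n + 2)) * fps_X ^ (2 * n + 2)) =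
    (fps_exp 1 - 1) / (fps_exp 1 + 1) *
      (\<Sum>n. fps_const (x n / fact (2 * n + 1)) * fps_X ^ (2 * n + 1))"
proof -
  define S where "S = (\<Sum>n. fps_const (x n / fact (2 * n + 1)) * fps_X ^ (2 * n + 1))"
  define Y where "Y = (\<Sum>n. fps_const (y n / fact (2 * n + 2)) * fps_X ^ (2 * n + 2))"
  define P where "P = (fps_exp 1 - 1) / (fps_exp 1 + 1) * S"
  have mono: "strict_mono (\<lambda>n::nat. 2 * n + 1)" "strict_mono (\<lambda>n::nat. 2 * n + 2)"
    by (auto simp: strict_mono_def)
  have S_odd: "fps_nth S (2 * k + 1) = x k / fact (2 * k + 1)" for k
    unfolding S_def by (rule fps_nth_suminf_monomials(1)[OF mono(1)])
  have S_even: "fps_nth S m = 0" if "even m" for m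
    unfolding S_def by (rule fps_nth_suminf_monomials(2)[OF mono(1)]) (use that in auto)
  have Y_pos: "fps_nth Y (2 * n + 2) = y n / fact (2 * n + 2)" for n
    unfolding Y_def by (rule fps_nth_suminf_monomials(1)[OF mono(2)])
  have Y_zero: "fps_nth Y m = 0" if "m = 0 \<or> odd m" for m
    unfolding Y_def by (rule fps_nth_suminf_monomials(2)[OF mono(2)]) (use that in auto)
  have P_pos_eq: "fps_nth P (2 * n + 2) = (\<Sum>k\<le>n. fps_nth S (2 * k + 1) *
      ((-1) ^ (n - k) * genocchi (2 * n - 2 * k + 2) / fact (2 * n - 2 * k + 2)))" for n
    unfolding P_def by (rule fps_nth_mult_half_tanh(2)) (rule S_even)
  have P_odd: "fps_nth P m = 0" if "odd m" for m
    unfolding P_def by (rule fps_nth_mult_half_tanh(1)[OF _ that]) (rule S_even)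
  have P_pos: "fps_nth P (2 * n + 2) = inf_mat_vec genocchi_matrix x n / fact (2 * n + 2)" for n
  proof -
    have "inf_mat_vec genocchi_matrix x n = (\<Sum>k\<le>n. genocchi_matrix n k * x k)"
      by (rule inf_mat_vec_lower_triangular) (simp add: genocchi_matrix_def)
    also have "\<dots> = fact (2 * n + 2) * fps_nth P (2 * n + 2)"
      unfolding P_pos_eq S_odd sum_distrib_left
      by (rule sum.cong) (simp_all only: atMost_iff genocchi_matrix_altdef divide_inverse mult_ac)
    finally show ?thesis by (simp del: fact_Suc)
  qed
  \<comment> \<open>The constant term of a product is the product of the constant terms, and that of
    \<open>S\<close> is 0.\<close>
  have P_zero: "fps_nth P m = 0" if "m = 0 \<or> odd m" for m
    using that P_odd S_even[of 0] by (auto simp: P_def)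
  \<comment> \<open>Both series vanish at 0 and at odd indices, so only positive even indices need
    comparing.\<close>
  have "Y = P \<longleftrightarrow> (\<forall>n. fps_nth Y (2 * n + 2) = fps_nth P (2 * n + 2))"
  proof
    assume *: "\<forall>n. fps_nth Y (2 * n + 2) = fps_nth P (2 * n + 2)"
    show "Y = P"
    proof (rule fps_ext)
      fix m
      show "fps_nth Y m = fps_nth P m"
      proof (cases "m = 0 \<or> odd m")
        case True
        then show ?thesis by (simp only: Y_zero P_zero)
      next
        case False
        then obtain k where "m = 2 * k" "k \<noteq> 0" by auto
        then have "m = 2 * (k - 1) + 2" by simp
        with * show ?thesis by metis
      qed
    qed
  qed simp
  \<comment> \<open>Both sides carry the same factorial denominator, nonzero in characteristic 0.
    Keeping \<open>fact\<close> folded lets it cancel.\<close>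
  also have "\<dots> \<longleftrightarrow> y = inf_mat_vec genocchi_matrix x"
    unfolding Y_pos P_pos fun_eq_iff by (simp del: fact_Suc)
  finally show ?thesis unfolding P_def Y_def S_def by (rule sym)
qed

end
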